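(* Fix a positive integer $n$. For positive integers $m$, write $m::n$ if there exists a prime power $p^k$ (with $k \ge 0$, so $1$ counts as a prime power) such that $n \mid p^k m$. Let $$S_\le := \langle \{ m \in \mathbb{N} : m \le n,\ m::n\}\rangle, \qquad S_\ge := \langle \{ m \in \mathbb{N} : m \ge n,\ m::n\}\rangle.$$ Then $S_\le = \langle \{ m : m::n\}\rangle$, both $S_\le$ and $S_\ge$ are numerical semigroups, and $$F(S_\le) = n\left(-1 + \sum_{1 < p^k \,\|\, n} \frac{p^k - 1}{p^k}\right), \qquad F(S_\ge) = n\left(-1 + \sum_{1 < p^k \,\|\, n} \frac{2p^k - 1}{p^k}\right),$$ where the sums range over prime powers $p^k > 1$ with $p^k \,\|\, n$.
   Context: $\mathbb{N}$ denotes the nonnegative integers (here $m$ ranges over positive integers). $p^k \,\|\, n$ means $p^k \mid n$ and $p^{k+1} \nmid n$. For a set $A$ of positive integers, $\langle A\rangle$ is the submonoid of $(\mathbb{N},+)$ generated by $A$. A numerical semigroup is a submonoid $S\subseteq\mathbb{N}$ with $\mathbb{N}\setminus S$ finite; its Frobenius number $F(S)$ is the largest integer not in $S$ (with $F(\mathbb{N})=-1$). *)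

theory Defs
  imports Complex_Main "HOL.Hull" "HOL-Computational_Algebra.Primes"
begin

definition is_submonoid :: "nat set \<Rightarrow> bool" where
  "is_submonoid S \<longleftrightarrow> 0 \<in> S \<and> (\<forall>a\<in>S. \<forall>b\<in>S. a + b \<in> S)"

definition generated_submonoid :: "nat set \<Rightarrow> nat set" where
  "generated_submonoid A = is_submonoid hull A"

definition numerical_semigroup :: "nat set \<Rightarrow> bool" where
  "numerical_semigroup S \<longleftrightarrow> is_submonoid S \<and> finite (UNIV - S)"

(* The maximum is taken over all integers, so that the value for S = UNIV is -1.
   Max is not usable here: the complement of S in the integers is infinite. *)
definition frobenius_number :: "nat set \<Rightarrow> int" where
  "frobenius_number S = (GREATEST z. z \<notin> int ` S)"

(* The relation m::n; it is meant for positive m and n only (0 satisfies it for every n). *)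
definition divides_up_to_prime_power :: "nat \<Rightarrow> nat \<Rightarrow> bool" where
  "divides_up_to_prime_power m n \<longleftrightarrow> (\<exists>p k. prime p \<and> n dvd p ^ k * m)"

definition S_le :: "nat \<Rightarrow> nat set" where
  "S_le n = generated_submonoid {m. 0 < m \<and> m \<le> n \<and> divides_up_to_prime_power m n}"

definition S_ge :: "nat \<Rightarrow> nat set" where
  "S_ge n = generated_submonoid {m. 0 < m \<and> m \<ge> n \<and> divides_up_to_prime_power m n}"

definition exact_power_dvd :: "nat \<Rightarrow> nat \<Rightarrow> nat \<Rightarrow> bool" where
  "exact_power_dvd p k n \<longleftrightarrow> p ^ k dvd n \<and> \<not> p ^ (k + 1) dvd n"

definition exact_prime_powers :: "nat \<Rightarrow> nat set" where
  "exact_prime_powers n = {p ^ k | p k. prime p \<and> 1 < p ^ k \<and> exact_power_dvd p k n}"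

end

(* Write n as the product of its exact prime powers q and put w q = n / q. By the Chinese
   remainder theorem every integer x is uniquely a sum of digits d q times w q, with
   0 <= d q < q, plus an integer multiple ("level") of n. The generators are the m with at most
   one nonzero digit, so the semigroup generated by those that are at least e * n, for e = 0
   or e = 1, consists of the x with level at least e times the number of nonzero digits. The
   largest x violating this has all digits q - 1, all nonzero, and level e * r - 1, where r is
   the number of exact prime powers. *)

theory Submission
  imports Defs "HOL-Number_Theory.Cong"
begin

section \<open>Generated submonoids and the Frobenius number\<close>

lemma is_submonoid_generated: "is_submonoid (generated_submonoid A)"
  \<comment> \<open>\<open>hull_in\<close> asks that every intersection of submonoids be a
    submonoid.\<close>
  unfolding generated_submonoid_def by (rule hull_in) (auto simp: is_submonoid_def)

lemma generated_submonoid_superset: "A \<subseteq> generated_submonoid A"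
  unfolding generated_submonoid_def by (rule hull_subset)

lemma generated_submonoid_minimal:
  "A \<subseteq> S \<Longrightarrow> is_submonoid S \<Longrightarrow> generated_submonoid A \<subseteq> S"
  unfolding generated_submonoid_def by (rule hull_minimal)

lemma is_submonoid_sum:
  assumes "is_submonoid S" "\<And>i. i \<in> I \<Longrightarrow> f i \<in> S"
  shows "sum f I \<in> S"
  using assms(2)
  by (induction I rule: infinite_finite_induct)
     (use assms(1) in \<open>auto simp: is_submonoid_def\<close>)

lemma is_submonoid_mult:
  assumes "is_submonoid S" "x \<in> S"
  shows "k * x \<in> S"
  by (induction k) (use assms in \<open>auto simp: is_submonoid_def\<close>)

lemma frobenius_number_eqI:
  assumes "z \<notin> int ` S" "\<And>y. y > z \<Longrightarrow> y \<in> int ` S"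
  shows "frobenius_number S = z"
  unfolding frobenius_number_def
  by (rule Greatest_equality) (use assms in \<open>auto simp: not_le[symmetric]\<close>)

section \<open>Digit expansions with respect to pairwise coprime moduli\<close>

locale coprime_moduli =
  fixes Q :: "nat set"
  assumes finite_Q: "finite Q"
    and coprime_Q: "\<And>p q. p \<in> Q \<Longrightarrow> q \<in> Q \<Longrightarrow> p \<noteq> q \<Longrightarrow> coprime p q"
    and gt_1: "\<And>q. q \<in> Q \<Longrightarrow> q > 1"
begin

definition N :: nat where "N = \<Prod>Q"

definition w :: "nat \<Rightarrow> nat" where "w q = \<Prod>(Q - {q})"

text \<open>The chosen number is an inverse of \<open>w q\<close> modulo \<open>q\<close> (see
  \<open>inverse_w\<close>), so the digit is the residue of \<open>x\<close> divided by
  \<open>w q\<close>. Being linear in \<open>x\<close> before reduction, it behaves well under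
  addition.\<close>

definition digit :: "nat \<Rightarrow> int \<Rightarrow> int" where
  "digit q x = (SOME u. [int (w q) * u = 1] (mod int q)) * x mod int q"

text \<open>The division is exact by \<open>expansion\<close>. Levels of negative integers are
  included because the Frobenius number may be negative.\<close>

definition level :: "int \<Rightarrow> int" where
  "level x = (x - (\<Sum>q\<in>Q. digit q x * int (w q))) div int N"

definition support :: "int \<Rightarrow> nat set" where
  "support x = {q \<in> Q. digit q x \<noteq> 0}"

lemma N_pos: "N > 0"
  unfolding N_def using gt_1 by (intro prod_pos) force

lemma w_pos: "w q > 0"
  unfolding w_def using gt_1 by (intro prod_pos) force

lemma N_eq: "q \<in> Q \<Longrightarrow> N = q * w q"
  unfolding N_def w_def using finite_Q by (simp add: prod.remove)

lemma finite_support: "finite (support x)"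
  unfolding support_def using finite_Q by simp

lemma digit_bounds:
  assumes "q \<in> Q"
  shows "0 \<le> digit q x" "digit q x < int q"
  using gt_1[OF assms] by (auto simp: digit_def)

lemma inverse_w:
  assumes "q \<in> Q"
  shows "[int (w q) * (SOME u. [int (w q) * u = 1] (mod int q)) = 1] (mod int q)"
proof (rule someI_ex)
  have "coprime (w q) q"
    unfolding w_def using assms coprime_Q by (intro prod_coprime_left) auto
  then show "\<exists>u. [int (w q) * u = 1] (mod int q)"
    by (intro cong_solve_coprime_int) simp
qed

lemma digit_w_cong:
  assumes "q \<in> Q"
  shows "[digit q x * int (w q) = x] (mod int q)"
proof -
  let ?u = "SOME u. [int (w q) * u = 1] (mod int q)"
  have "[digit q x * int (w q) = (?u * x) * int (w q)] (mod int q)"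
    unfolding digit_def by (intro cong_mult) auto
  also have "(?u * x) * int (w q) = (int (w q) * ?u) * x"
    by (simp add: mult_ac)
  also have "[(int (w q) * ?u) * x = 1 * x] (mod int q)"
    by (intro cong_mult inverse_w assms) auto
  finally show ?thesis by simp
qed

lemma digit_unique:
  assumes "q \<in> Q" "0 \<le> c" "c < int q" "[c * int (w q) = x] (mod int q)"
  shows "digit q x = c"
proof -
  let ?u = "SOME u. [int (w q) * u = 1] (mod int q)"
  have "[?u * x = ?u * (c * int (w q))] (mod int q)"
    by (intro cong_mult cong_sym[OF assms(4)]) auto
  also have "?u * (c * int (w q)) = (int (w q) * ?u) * c"
    by (simp add: mult_ac)
  also have "[(int (w q) * ?u) * c = 1 * c] (mod int q)"
    by (intro cong_mult inverse_w assms) auto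
  finally show ?thesis
    unfolding digit_def using assms by (simp add: cong_def)
qed

lemma digit_add:
  assumes "q \<in> Q"
  shows "digit q (x + y) = (digit q x + digit q y) mod int q"
  unfolding digit_def by (simp add: mod_add_eq distrib_left)

lemma dvd_w:
  assumes "p \<in> Q" "p \<noteq> q"
  shows "p dvd w q"
  unfolding w_def using assms finite_Q by (intro dvd_prodI[of _ _ "\<lambda>x. x", simplified]) auto

text \<open>Modulo \<open>p\<close> the other summands vanish, since \<open>p\<close> divides
  \<open>w q\<close> for every \<open>q\<close> different from \<open>p\<close>.\<close>

lemma sum_w_cong:
  assumes "p \<in> Q"
  shows "[(\<Sum>q\<in>Q. c q * int (w q)) = c p * int (w p)] (mod int p)"
proof -
  have "int p dvd (\<Sum>q\<in>Q-{p}. c q * int (w q))"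
    using dvd_w[OF assms] by (intro dvd_sum) auto
  then show ?thesis
    using assms finite_Q by (simp add: sum.remove cong_iff_dvd_diff)
qed

lemma N_dvd:
  fixes x :: int
  assumes "\<And>q. q \<in> Q \<Longrightarrow> int q dvd x"
  shows "int N dvd x"
proof -
  have "[x = 0] (mod (\<Prod>q\<in>Q. int q))"
    using coprime_Q assms by (intro cong_cong_prod_coprime) (auto simp: cong_0_iff)
  then show ?thesis by (simp add: N_def cong_0_iff)
qed

text \<open>The digit sum agrees with \<open>x\<close> modulo each \<open>q\<close>, hence modulo
  their product \<open>N\<close> by coprimality.\<close>

lemma expansion: "x = (\<Sum>q\<in>Q. digit q x * int (w q)) + level x * int N"
proof -
  have "int N dvd x - (\<Sum>q\<in>Q. digit q x * int (w q))"
  proof (rule N_dvd)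
    fix q assume q: "q \<in> Q"
    have "[(\<Sum>q\<in>Q. digit q x * int (w q)) = x] (mod int q)"
      using sum_w_cong[OF q] digit_w_cong[OF q] by (rule cong_trans)
    then show "int q dvd x - (\<Sum>q\<in>Q. digit q x * int (w q))"
      by (simp add: cong_iff_dvd_diff dvd_diff_commute)
  qed
  then show ?thesis by (simp add: level_def)
qed

text \<open>Reducing a digit sum modulo \<open>q\<close> removes a multiple of
  \<open>q * w q = N\<close>; this carry can only raise the level.\<close>

lemma level_superadditive: "level x + level y \<le> level (x + y)"
proof -
  have "(\<Sum>q\<in>Q. digit q (x + y) * int (w q))
      \<le> (\<Sum>q\<in>Q. (digit q x + digit q y) * int (w q))"
    by (intro sum_mono mult_right_mono)
       (auto simp: digit_add digit_bounds intro!: zmod_le_nonneg_dividend add_nonneg_nonneg)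
  then have "(level x + level y) * int N \<le> level (x + y) * int N"
    using expansion[of x] expansion[of y] expansion[of "x + y"]
    by (simp add: sum.distrib algebra_simps)
  then show ?thesis using N_pos by simp
qed

lemma card_support_subadditive:
  "card (support (x + y)) \<le> card (support x) + card (support y)"
proof -
  have "support (x + y) \<subseteq> support x \<union> support y"
    by (auto simp: support_def digit_add)
  then have "card (support (x + y)) \<le> card (support x \<union> support y)"
    using finite_support by (intro card_mono) auto
  then show ?thesis using card_Un_le[of "support x" "support y"] by linarith
qed

definition T :: "nat \<Rightarrow> nat set" where
  "T e = {x. level (int x) \<ge> int (e * card (support (int x)))}"

text \<open>Under addition the level is superadditive while the number of nonzero digits is
  subadditive, so the defining inequality survives.\<close>

lemma is_submonoid_T: "is_submonoid (T e)"
proof -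
  have "digit q 0 = 0" for q by (simp add: digit_def)
  then have "0 \<in> T e" by (simp add: T_def level_def support_def)
  moreover have "a + b \<in> T e" if "a \<in> T e" "b \<in> T e" for a b
  proof -
    have "int (e * card (support (int a + int b)))
        \<le> int (e * card (support (int a))) + int (e * card (support (int b)))"
      using mult_le_mono2[OF card_support_subadditive, of e "int a" "int b"]
      by (simp add: algebra_simps flip: of_nat_mult of_nat_add)
    then show ?thesis
      using that level_superadditive[of "int a" "int b"] by (simp add: T_def)
  qed
  ultimately show ?thesis by (simp add: is_submonoid_def)
qed

lemma sum_of_bool_support:
  "(\<Sum>q\<in>Q. of_bool (digit q x \<noteq> 0)) = int (card (support x))"
  using finite_Q by (simp add: support_def sum.If_cases of_bool_def Int_def)

text \<open>A single digit contributes at most \<open>(q - 1) * w q\<close>, which is less than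
  \<open>N\<close>. So \<open>x \<ge> e * N\<close> forces level at least \<open>e\<close>, and at
  most one nonzero digit has to be paid for.\<close>

lemma mem_T_if_card_support_le_1:
  assumes "card (support (int x)) \<le> 1" "x \<ge> e * N"
  shows "x \<in> T e"
proof -
  have "(\<Sum>q\<in>Q. digit q (int x) * int (w q)) = (\<Sum>q\<in>support (int x). digit q (int x) * int (w q))"
    using finite_Q by (intro sum.mono_neutral_right) (auto simp: support_def)
  also have "\<dots> < int N"
  proof (cases "support (int x) = {}")
    case True
    then show ?thesis using N_pos by simp
  next
    case False
    with assms(1) finite_support[of "int x"] obtain q where q: "support (int x) = {q}"
      by (metis card_0_eq card_1_singletonE le_antisym less_one not_le)
    then have "q \<in> Q" by (auto simp: support_def)
    then show ?thesis
      using q digit_bounds(2)[of q "int x"] w_pos[of q] by (simp add: N_eq)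
  qed
  finally have "int x < (level (int x) + 1) * int N"
    using expansion[of "int x"] by (simp add: algebra_simps)
  moreover have "int e * int N \<le> int x"
    using assms(2) by (simp flip: of_nat_mult)
  ultimately have "int e * int N < (level (int x) + 1) * int N" by linarith
  then have "int e \<le> level (int x)" using N_pos by simp
  moreover have "e * card (support (int x)) \<le> e * 1"
    using assms(1) by (rule mult_le_mono2)
  ultimately have "int (e * card (support (int x))) \<le> level (int x)" by linarith
  then show ?thesis by (simp add: T_def)
qed

text \<open>Each nonzero digit \<open>c\<close> is raised to \<open>c + e * q\<close> at the cost of \<open>e\<close> levels.\<close>

lemma mem_if_level_ge:
  assumes S: "is_submonoid S" "N \<in> S"
    and gen: "\<And>q c. q \<in> Q \<Longrightarrow> 0 < c \<Longrightarrow> c < q \<Longrightarrow> (c + e * q) * w q \<in> S"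
    and x: "level x \<ge> int (e * card (support x))"
  shows "x \<in> int ` S"
proof -
  \<comment> \<open>For a nonzero digit \<open>f q\<close> is one of the elements given by
    \<open>gen\<close>, otherwise it is 0. The level left over after paying for the nonzero digits
    is nonnegative by \<open>x\<close> and is spent on copies of \<open>N\<close>.\<close>
  define f where "f q = (nat (digit q x) + e * q * of_bool (digit q x \<noteq> 0)) * w q" for q
  define y where "y = (\<Sum>q\<in>Q. f q) + nat (level x - int (e * card (support x))) * N"
  have "f q \<in> S" if q: "q \<in> Q" for q
  proof (cases "digit q x = 0")
    case True
    then show ?thesis using S by (simp add: f_def is_submonoid_def)
  next
    case False
    then show ?thesis
      using gen[OF q, of "nat (digit q x)"] digit_bounds[OF q, of x] by (simp add: f_def)
  qed
  then have "y \<in> S"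
    unfolding y_def using S is_submonoid_sum is_submonoid_mult by (meson is_submonoid_def)
  moreover have "x = int y"
  proof -
    have "int (f q) = digit q x * int (w q) + int e * int N * of_bool (digit q x \<noteq> 0)"
      if q: "q \<in> Q" for q
      using digit_bounds[OF q, of x] by (simp add: f_def N_eq[OF q] algebra_simps)
    then have "(\<Sum>q\<in>Q. int (f q))
        = (\<Sum>q\<in>Q. digit q x * int (w q)) + int e * int N * int (card (support x))"
      by (simp add: sum.distrib flip: sum_distrib_left sum_of_bool_support)
    then show ?thesis
      using x expansion[of x] by (simp add: y_def algebra_simps)
  qed
  ultimately show ?thesis by blast
qed

text \<open>Since \<open>q * w q = N\<close>, the summand equals
  \<open>(q - 1) * w q + e * N\<close>: the largest digit together with its \<open>e\<close> levels.
  The final \<open>- int N\<close> takes one level away. For empty \<open>Q\<close> this gives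
  -1.\<close>

definition F :: "nat \<Rightarrow> int" where
  "F e = (\<Sum>q\<in>Q. int ((1 + e) * N) - int (w q)) - int N"

text \<open>If the inequality fails, bounding the contribution of each \<open>q\<close>, levels
  included, by that of the largest digit gives \<open>z \<le> F e\<close>.\<close>

lemma level_ge_if_gt_F:
  assumes "z > F e"
  shows "level z \<ge> int (e * card (support z))"
proof (rule ccontr)
  assume "\<not> ?thesis"
  \<comment> \<open>Failure over the integers leaves the level short by at least 1; this 1 becomes
    the \<open>- int N\<close> of \<open>F e\<close>.\<close>
  then have "level z * int N \<le> (int e * int (card (support z)) - 1) * int N"
    by (intro mult_right_mono) auto
  then have "z \<le> (\<Sum>q\<in>Q. digit q z * int (w q)) + int e * int N * int (card (support z)) - int N"
    using expansion[of z] by (simp add: algebra_simps)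
  also have "\<dots> = (\<Sum>q\<in>Q. digit q z * int (w q) + int e * int N * of_bool (digit q z \<noteq> 0)) - int N"
    by (simp add: sum.distrib flip: sum_distrib_left sum_of_bool_support)
  also have "\<dots> \<le> F e"
    unfolding F_def
  proof (intro diff_right_mono sum_mono)
    fix q assume q: "q \<in> Q"
    have "digit q z * int (w q) \<le> (int q - 1) * int (w q)"
      using digit_bounds[OF q, of z] by (intro mult_right_mono) auto
    moreover have "int e * int N * of_bool (digit q z \<noteq> 0) \<le> int e * int N" by simp
    ultimately show "digit q z * int (w q) + int e * int N * of_bool (digit q z \<noteq> 0)
        \<le> int ((1 + e) * N) - int (w q)"
      by (simp add: N_eq[OF q] algebra_simps)
  qed
  finally show False using assms by simp
qed

text \<open>Rewriting \<open>F e\<close> as a digit sum plus a multiple of \<open>N\<close> exhibits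
  its expansion: all digits are \<open>q - 1\<close>, nonzero because \<open>q > 1\<close>, and the
  level is one short of \<open>e * card Q\<close>.\<close>

lemma level_F_less: "level (F e) < int (e * card (support (F e)))"
proof -
  have "(\<Sum>q\<in>Q. int ((1 + e) * N) - int (w q))
      = (\<Sum>q\<in>Q. (int q - 1) * int (w q) + int e * int N)"
    by (intro sum.cong) (auto simp: N_eq algebra_simps)
  also have "\<dots> = (\<Sum>q\<in>Q. (int q - 1) * int (w q)) + int e * int (card Q) * int N"
    by (simp add: sum.distrib)
  finally have "F e = (\<Sum>q\<in>Q. (int q - 1) * int (w q))
      + int e * int (card Q) * int N - int N"
    unfolding F_def by (rule arg_cong)
  then have F: "F e = (\<Sum>q\<in>Q. (int q - 1) * int (w q)) + (int e * int (card Q) - 1) * int N"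
    by (simp only: left_diff_distrib mult_1)
  have digit: "digit q (F e) = int q - 1" if q: "q \<in> Q" for q
  proof (rule digit_unique[OF q])
    have "int q dvd (int e * int (card Q) - 1) * int N" by (simp add: N_eq[OF q])
    then have "[F e = (\<Sum>q\<in>Q. (int q - 1) * int (w q))] (mod int q)"
      by (simp add: F cong_iff_dvd_diff)
    then show "[(int q - 1) * int (w q) = F e] (mod int q)"
      by (rule cong_sym[OF cong_trans[OF _ sum_w_cong[OF q]]])
  qed (use gt_1[OF q] in auto)
  then have "support (F e) = Q" using gt_1 by (force simp: support_def)
  moreover have "level (F e) = int e * int (card Q) - 1"
    unfolding level_def using F N_pos digit by simp
  ultimately show ?thesis by simp
qed

text \<open>The common criterion for both semigroups: \<open>S \<subseteq> T e\<close> keeps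
  \<open>F e\<close> out of \<open>S\<close>, and the listed elements suffice to build everything in
  \<open>T e\<close>.\<close>

lemma semigroup_eq_T:
  assumes "is_submonoid S" "N \<in> S" "S \<subseteq> T e"
    and "\<And>q c. q \<in> Q \<Longrightarrow> 0 < c \<Longrightarrow> c < q \<Longrightarrow> (c + e * q) * w q \<in> S"
  shows "S = T e" "numerical_semigroup S" "frobenius_number S = F e"
proof -
  have mem: "x \<in> int ` S" if "level x \<ge> int (e * card (support x))" for x
    using mem_if_level_ge[OF assms(1,2,4) that] .
  have "T e \<subseteq> S"
  proof
    fix x assume "x \<in> T e"
    then show "x \<in> S" using mem[of "int x"] by (auto simp: T_def)
  qed
  then show "S = T e" using assms(3) by blast
  \<comment> \<open>Here \<open>z\<close> is any integer; its nonnegativity is part of the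
    conclusion, as the Frobenius number is a maximum over the integers.\<close>
  have gt: "z \<in> int ` S" if "z > F e" for z
    using mem level_ge_if_gt_F[OF that] .
  have "UNIV - S \<subseteq> {..nat (F e)}"
  proof
    fix x assume "x \<in> UNIV - S"
    then have "\<not> int x > F e" using gt[of "int x"] by auto
    then show "x \<in> {..nat (F e)}" by auto
  qed
  then show "numerical_semigroup S"
    unfolding numerical_semigroup_def using assms(1) finite_subset by blast
  have "F e \<notin> int ` S"
    using level_F_less[of e] assms(3) by (force simp: T_def)
  then show "frobenius_number S = F e" using gt by (intro frobenius_number_eqI)
qed

lemma real_F:
  "real_of_int (F e) = real N * (-1 + (\<Sum>q\<in>Q. (real (e + 1) * real q - 1) / real q))"
proof -
  have "real N * ((real (e + 1) * real q - 1) / real q) = real ((1 + e) * N) - real (w q)"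
    if q: "q \<in> Q" for q
    using gt_1[OF q] by (simp add: N_eq[OF q] field_simps)
  then have "real N * (\<Sum>q\<in>Q. (real (e + 1) * real q - 1) / real q)
      = (\<Sum>q\<in>Q. real ((1 + e) * N) - real (w q))"
    unfolding sum_distrib_left by (rule sum.cong[OF refl])
  then show ?thesis
    by (simp add: F_def algebra_simps)
qed

end

section \<open>The exact prime powers of a positive integer\<close>

lemma exact_prime_powers_eq:
  assumes "n > 0"
  shows "exact_prime_powers n = (\<lambda>p. p ^ multiplicity p n) ` prime_factors n"
proof (intro subset_antisym subsetI)
  fix q assume "q \<in> exact_prime_powers n"
  then obtain p k where pk: "q = p ^ k" "prime p" "1 < p ^ k" "p ^ k dvd n" "\<not> p ^ Suc k dvd n"
    by (auto simp: exact_prime_powers_def exact_power_dvd_def)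
  then have "multiplicity p n = k" by (intro multiplicity_eqI)
  moreover have "p dvd n"
    using pk by (metis dvd_power dvd_trans gr0I less_irrefl power_0)
  ultimately show "q \<in> (\<lambda>p. p ^ multiplicity p n) ` prime_factors n"
    using pk assms by (auto simp: prime_factors_dvd)
next
  fix q assume "q \<in> (\<lambda>p. p ^ multiplicity p n) ` prime_factors n"
  then obtain p where p: "prime p" "p dvd n" "q = p ^ multiplicity p n"
    by (auto simp: prime_factors_dvd)
  then have "multiplicity p n > 0"
    using assms by (simp add: prime_multiplicity_gt_zero_iff)
  then have "1 < p ^ multiplicity p n"
    using prime_gt_1_nat[OF p(1)] by (intro one_less_power)
  moreover have "\<not> p ^ Suc (multiplicity p n) dvd n"
    using assms prime_gt_1_nat[OF p(1)] by (subst power_dvd_iff_le_multiplicity) auto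
  ultimately show "q \<in> exact_prime_powers n"
    using p multiplicity_dvd[of p n]
    unfolding exact_prime_powers_def exact_power_dvd_def
    by (metis (mono_tags, lifting) Suc_eq_plus1 mem_Collect_eq)
qed

lemma coprime_moduli_exact_prime_powers:
  assumes "n > 0"
  shows "coprime_moduli (exact_prime_powers n)"
proof
  show "finite (exact_prime_powers n)"
    by (simp add: exact_prime_powers_eq[OF assms])
  fix q assume q: "q \<in> exact_prime_powers n"
  then show "1 < q" by (auto simp: exact_prime_powers_def)
  fix p assume p: "p \<in> exact_prime_powers n" "p \<noteq> q"
  obtain a where a: "prime a" "p = a ^ multiplicity a n"
    using p(1) by (auto simp: exact_prime_powers_eq[OF assms])
  obtain b where b: "prime b" "q = b ^ multiplicity b n"
    using q by (auto simp: exact_prime_powers_eq[OF assms])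
  have "a \<noteq> b"
  proof
    assume "a = b"
    then have "p = q" by (subst a(2), subst b(2)) (rule arg_cong)
    with p(2) show False by contradiction
  qed
  then have "coprime a b" by (rule primes_coprime[OF a(1) b(1)])
  then show "coprime p q" by (subst a(2), subst b(2)) simp
qed

lemma prod_exact_prime_powers:
  assumes "n > 0"
  shows "\<Prod>(exact_prime_powers n) = n"
proof -
  \<comment> \<open>The product runs over the values \<open>q\<close>, so distinct primes must give
    distinct powers before it can be reindexed by primes.\<close>
  have "inj_on (\<lambda>p. p ^ multiplicity p n) (prime_factors n)"
  proof (rule inj_onI)
    fix p q assume pq: "p \<in> prime_factors n" "q \<in> prime_factors n"
      "p ^ multiplicity p n = q ^ multiplicity q n"
    then have "multiplicity p n > 0" "prime p" "prime q"
      using assms by (auto simp: prime_factors_multiplicity)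
    then have "p dvd q ^ multiplicity q n" using pq(3) by (metis dvd_power)
    then show "p = q"
      using \<open>prime p\<close> \<open>prime q\<close> prime_dvd_power primes_dvd_imp_eq by blast
  qed
  then have "\<Prod>(exact_prime_powers n) = (\<Prod>p\<in>prime_factors n. p ^ multiplicity p n)"
    by (simp add: exact_prime_powers_eq[OF assms] prod.reindex)
  also have "\<dots> = n" using assms by (simp add: prime_factorization_nat[symmetric])
  finally show ?thesis .
qed

section \<open>Application to \<open>S_le\<close> and \<open>S_ge\<close>\<close>

context
  fixes n :: nat
  assumes n: "n > 0"
begin

interpretation coprime_moduli "exact_prime_powers n"
  using n by (rule coprime_moduli_exact_prime_powers)

lemma N_eq_n: "N = n"
  unfolding N_def using n by (rule prod_exact_prime_powers)

text \<open>The factor \<open>p ^ k\<close> can only help with the exact power of \<open>p\<close>.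
  Any other exact prime power \<open>q\<close> is coprime to it, hence divides \<open>m\<close>,
  which makes its digit 0.\<close>

lemma card_support_le_1:
  assumes "divides_up_to_prime_power m n"
  shows "card (support (int m)) \<le> 1"
proof -
  from assms obtain p k where p: "prime p" "n dvd p ^ k * m"
    by (auto simp: divides_up_to_prime_power_def)
  have "support (int m) \<subseteq> {p ^ multiplicity p n}"
  proof
    fix q assume "q \<in> support (int m)"
    then have q: "q \<in> exact_prime_powers n" "digit q (int m) \<noteq> 0"
      by (auto simp: support_def)
    then obtain r where r: "prime r" "q = r ^ multiplicity r n"
      by (auto simp: exact_prime_powers_eq[OF n])
    show "q \<in> {p ^ multiplicity p n}"
    proof (cases "r = p")
      case False
      then have "coprime q (p ^ k)"
        using p r by (auto intro!: primes_coprime)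
      moreover have "q dvd p ^ k * m"
        using p(2) N_eq[OF q(1)] by (metis N_eq_n dvd_mult_left)
      ultimately have "q dvd m" by (simp add: coprime_dvd_mult_right_iff)
      then have "digit q (int m) = 0"
        using gt_1[OF q(1)]
        by (intro digit_unique[OF q(1)]) (auto simp: cong_iff_dvd_diff)
      with q(2) show ?thesis by simp
    qed (use r in simp)
  qed
  then have "card (support (int m)) \<le> card {p ^ multiplicity p n}"
    by (intro card_mono) auto
  then show ?thesis by simp
qed

text \<open>The prime power to multiply by is \<open>q\<close> itself, as
  \<open>q * w q = n\<close>.\<close>

lemma divides_up_to_prime_power_w:
  assumes "q \<in> exact_prime_powers n"
  shows "divides_up_to_prime_power (c * w q) n"
proof -
  obtain p k where "prime p" "q = p ^ k"
    using assms by (auto simp: exact_prime_powers_def)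
  moreover have "n dvd q * (c * w q)"
    using N_eq[OF assms] N_eq_n by (metis dvd_triv_right mult.left_commute)
  ultimately show ?thesis by (auto simp: divides_up_to_prime_power_def)
qed

lemma divides_up_to_prime_power_refl: "divides_up_to_prime_power n n"
  unfolding divides_up_to_prime_power_def using two_is_prime_nat by (metis dvd_triv_right)

text \<open>As \<open>T e\<close> is a submonoid, only generators need checking. The bound
  \<open>e * n \<le> m\<close> is void for \<open>e = 0\<close> and is that of \<open>S_ge\<close>
  for \<open>e = 1\<close>.\<close>

lemma generated_subset_T:
  "generated_submonoid {m. 0 < m \<and> e * n \<le> m \<and> divides_up_to_prime_power m n} \<subseteq> T e"
  by (intro generated_submonoid_minimal is_submonoid_T)
     (auto intro!: mem_T_if_card_support_le_1 card_support_le_1 simp: N_eq_n)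

lemma S_ge:
  "numerical_semigroup (S_ge n)" "frobenius_number (S_ge n) = F 1"
proof -
  have sub: "{m. 0 < m \<and> m \<ge> n \<and> divides_up_to_prime_power m n} \<subseteq> S_ge n"
    unfolding S_ge_def by (rule generated_submonoid_superset)
  have *: "is_submonoid (S_ge n)" "N \<in> S_ge n" "S_ge n \<subseteq> T 1"
    "\<And>q c. q \<in> exact_prime_powers n \<Longrightarrow> 0 < c \<Longrightarrow> c < q \<Longrightarrow> (c + 1 * q) * w q \<in> S_ge n"
  proof -
    show "is_submonoid (S_ge n)" unfolding S_ge_def by (rule is_submonoid_generated)
    show "N \<in> S_ge n" using sub n divides_up_to_prime_power_refl by (auto simp: N_eq_n)
    show "S_ge n \<subseteq> T 1" unfolding S_ge_def using generated_subset_T[of 1] by simp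
    fix q c :: nat
    assume q: "q \<in> exact_prime_powers n" and c: "0 < c"
    \<comment> \<open>Adding \<open>q\<close> to the digit adds \<open>q * w q = n\<close>, which
      lifts \<open>c * w q\<close> past the threshold.\<close>
    have "n \<le> (c + q) * w q" using N_eq[OF q] N_eq_n by (simp add: algebra_simps)
    then show "(c + 1 * q) * w q \<in> S_ge n"
      using sub divides_up_to_prime_power_w[OF q, of "c + q"] c w_pos[of q] by auto
  qed
  show "numerical_semigroup (S_ge n)" "frobenius_number (S_ge n) = F 1"
    using semigroup_eq_T[OF *] by blast+
qed

lemma S_le:
  "S_le n = generated_submonoid {m. 0 < m \<and> divides_up_to_prime_power m n}"
  "numerical_semigroup (S_le n)" "frobenius_number (S_le n) = F 0"
proof -
  let ?G = "generated_submonoid {m. 0 < m \<and> divides_up_to_prime_power m n}"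
  have sub: "{m. 0 < m \<and> m \<le> n \<and> divides_up_to_prime_power m n} \<subseteq> S_le n"
    unfolding S_le_def by (rule generated_submonoid_superset)
  have le: "S_le n \<subseteq> ?G"
    unfolding S_le_def generated_submonoid_def by (rule hull_mono) auto
  have G: "?G \<subseteq> T 0" using generated_subset_T[of 0] by simp
  have *: "is_submonoid (S_le n)" "N \<in> S_le n" "S_le n \<subseteq> T 0"
    "\<And>q c. q \<in> exact_prime_powers n \<Longrightarrow> 0 < c \<Longrightarrow> c < q \<Longrightarrow> (c + 0 * q) * w q \<in> S_le n"
  proof -
    show "is_submonoid (S_le n)" unfolding S_le_def by (rule is_submonoid_generated)
    show "N \<in> S_le n" using sub n divides_up_to_prime_power_refl by (auto simp: N_eq_n)
    show "S_le n \<subseteq> T 0" using le G by blast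
    fix q c :: nat
    assume q: "q \<in> exact_prime_powers n" and c: "0 < c" "c < q"
    \<comment> \<open>A proper digit \<open>c < q\<close> keeps the generator below
      \<open>q * w q = n\<close>.\<close>
    have "c * w q \<le> n" using N_eq[OF q] N_eq_n mult_le_mono1[of c q "w q"] c by simp
    then show "(c + 0 * q) * w q \<in> S_le n"
      using sub divides_up_to_prime_power_w[OF q, of c] c w_pos[of q] by auto
  qed
  show "numerical_semigroup (S_le n)" "frobenius_number (S_le n) = F 0"
    using semigroup_eq_T[OF *] by blast+
  \<comment> \<open>The chain \<open>S_le n \<subseteq> ?G \<subseteq> T 0 = S_le n\<close> closes
    up.\<close>
  show "S_le n = ?G" using semigroup_eq_T(1)[OF *] le G by blast
qed

lemmas real_F_n = real_F[unfolded N_eq_n]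

text \<open>Folding trades \<open>F 0\<close> and \<open>F 1\<close> for the Frobenius numbers, so
  the formulas can be used outside the interpretation.\<close>

lemmas frobenius_number_S_le = real_F_n[of 0, folded S_le(3)]
lemmas frobenius_number_S_ge = real_F_n[of 1, folded S_ge(2)]

end

theorem theorem1p5:
  fixes n :: nat
  assumes "n > 0"
  shows "S_le n = generated_submonoid {m. 0 < m \<and> divides_up_to_prime_power m n}
    \<and> numerical_semigroup (S_le n)
    \<and> numerical_semigroup (S_ge n)
    \<and> real_of_int (frobenius_number (S_le n)) =
        real n * (-1 + (\<Sum>q\<in>exact_prime_powers n. (real q - 1) / real q))
    \<and> real_of_int (frobenius_number (S_ge n)) =
        real n * (-1 + (\<Sum>q\<in>exact_prime_powers n. (2 * real q - 1) / real q))"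
  using S_le(1,2)[OF assms] S_ge(1)[OF assms]
    frobenius_number_S_le[OF assms] frobenius_number_S_ge[OF assms]
  by simp

end
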